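(* Suppose that $c_*>0$, put $\alpha_*:=c_*^2/(1+c_*^2)$, and let $$\mathcal G:=\Big\{g:\ g(\theta)=\int\phi_{c_*}(\theta-\xi)\,dH(\xi),\ H\in\mathcal P(\mathbb R)\Big\}.$$ Then, for all sufficiently large $n$, $$\inf_{\hat g_n}\sup_{g\in\mathcal G}\mathbb E_g\big[\|\hat g_n-g\|_{L_2}^2\big]\gtrsim_{c_*}n^{-\alpha_*}(\log n)^{-1/2},$$ where $\mathbb E_g$ denotes expectation when $X_i=\theta_i+Z_i$, $\theta_i\overset{iid}{\sim}g\in\mathcal G$, $Z_i\overset{iid}{\sim}N(0,1)$, with $\theta_i$ and $Z_i$ independent for $i=1,\dots,n$, and the infimum is over all measurable functions $\hat g_n$ based on the data $X_1,\dots,X_n$.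
   Context: $\mathcal P(\mathbb R)$ is the set of Borel probability measures on $\mathbb R$; $\phi_\sigma$ is the $N(0,\sigma^2)$ density. $a\gtrsim_{c_*}b$ means $a\ge Cb$ for a constant $C>0$ depending only on $c_*$. *)

theory Defs
  imports "HOL-Probability.Probability"
begin

definition normal_mixture_density :: "real \<Rightarrow> real measure \<Rightarrow> real \<Rightarrow> real" where
  "normal_mixture_density c H = (\<lambda>\<theta>. \<integral>\<xi>. normal_density 0 c (\<theta> - \<xi>) \<partial>H)"

definition mixture_class :: "real \<Rightarrow> (real \<Rightarrow> real) set" where
  "mixture_class c =
     {g. \<exists>H. prob_space H \<and> sets H = sets borel \<and> g = normal_mixture_density c H}"

definition latent_law :: "nat \<Rightarrow> (real \<Rightarrow> real) \<Rightarrow> (nat \<Rightarrow> real \<times> real) measure" where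
  "latent_law n g =
     (\<Pi>\<^sub>M i\<in>{..<n}. density lborel g \<Otimes>\<^sub>M density lborel (normal_density 0 1))"

definition data_law :: "nat \<Rightarrow> (real \<Rightarrow> real) \<Rightarrow> (nat \<Rightarrow> real) measure" where
  "data_law n g =
     distr (latent_law n g) (\<Pi>\<^sub>M i\<in>{..<n}. borel)
       (\<lambda>\<omega>. \<lambda>i\<in>{..<n}. fst (\<omega> i) + snd (\<omega> i))"

text \<open>An estimator sends the data \<open>x\<close> to a function on the line. Measurability is joint in the data
  and the argument of that function. No integrability is demanded: losses take values in
  \<open>[0, \<infinity>]\<close>.\<close>

definition estimators :: "nat \<Rightarrow> ((nat \<Rightarrow> real) \<Rightarrow> real \<Rightarrow> real) set" where
  "estimators n =
     {e. case_prod e \<in> borel_measurable ((\<Pi>\<^sub>M i\<in>{..<n}. borel) \<Otimes>\<^sub>M borel)}"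

definition sq_L2_dist :: "(real \<Rightarrow> real) \<Rightarrow> (real \<Rightarrow> real) \<Rightarrow> ennreal" where
  "sq_L2_dist f g = (\<integral>\<^sup>+\<theta>. ennreal ((f \<theta> - g \<theta>)\<^sup>2) \<partial>lborel)"

definition risk ::
  "nat \<Rightarrow> ((nat \<Rightarrow> real) \<Rightarrow> real \<Rightarrow> real) \<Rightarrow> (real \<Rightarrow> real) \<Rightarrow> ennreal" where
  "risk n e g = (\<integral>\<^sup>+x. sq_L2_dist (e x) g \<partial>data_law n g)"

definition minimax_risk :: "nat \<Rightarrow> real \<Rightarrow> ennreal" where
  "minimax_risk n c = (INF e\<in>estimators n. SUP g\<in>mixture_class c. risk n e g)"

end

theory Submission
  imports Defs
begin

text \<open>The lower bound comes from Le Cam's method with two explicit mixtures. Write \<open>N\<^sub>\<sigma>\<close> for the centred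
  normal density with standard deviation \<open>\<sigma>\<close>. Take the mixing measures with densities \<open>N\<^sub>\<tau> x\<close> and
  \<open>N\<^sub>\<tau> x * (1 + \<epsilon> * sin (b * x))\<close>. The second is a probability density because the perturbation is odd
  and \<open>\<bar>\<epsilon>\<bar> \<le> 1\<close>. Completing the square shows that convolution with \<open>N\<^sub>s\<close> sends
  \<open>N\<^sub>\<tau> x * (1 + \<epsilon> * sin (b * x))\<close> to a function of the same form: the variance becomes \<open>\<tau>\<^sup>2 + s\<^sup>2\<close>, the
  frequency shrinks by the factor \<open>\<tau>\<^sup>2 / (\<tau>\<^sup>2 + s\<^sup>2)\<close>, and the amplitude by
  \<open>exp (- b\<^sup>2 * \<tau>\<^sup>2 * s\<^sup>2 / (2 * (\<tau>\<^sup>2 + s\<^sup>2)))\<close> (\<open>normal_convolve_sine_tilted_normal\<close>). Hence the two latent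
  densities (\<open>s = c\<close>) and the two densities of one observation (\<open>s\<^sup>2 = 1 + c\<^sup>2\<close>) are all known in closed
  form.

  For the observations the likelihood ratio of one sample point is \<open>1 + \<delta> * sin (w * x)\<close>, so its second
  moment is at most \<open>1 + \<delta>\<^sup>2\<close>, and the two laws of \<open>n\<close> observations overlap by a constant as soon as
  \<open>n * \<delta>\<^sup>2 \<le> 1 / 4\<close> (\<open>two_point_testing_bound\<close>). Every estimator then has risk at least a constant times
  the squared distance of the two latent densities (\<open>minimax_risk_two_point\<close>), which a Gaussian integral
  evaluates (\<open>sq_L2_dist_sine_tilted_normal\<close>).

  The rate results from \<open>b\<^sup>2 = \<tau>\<^sup>2 = ln n / (1 + c\<^sup>2)\<close>. Because \<open>\<tau>\<close> grows as fast as \<open>b\<close>, the exponents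
  \<open>b\<^sup>2 * \<tau>\<^sup>2 * s\<^sup>2 / (\<tau>\<^sup>2 + s\<^sup>2)\<close> differ from \<open>b\<^sup>2 * s\<^sup>2\<close> by a bounded amount. The squared amplitude is
  therefore of order \<open>1 / n\<close> in the observations and \<open>n powr (- \<alpha>)\<close> in the latent densities, while
  integrating \<open>N\<^sub>\<sigma>\<^sup>2\<close> contributes the factor \<open>1 / \<sigma>\<close>, of order \<open>1 / sqrt (ln n)\<close>.\<close>

section \<open>Trigonometric integrals of normal densities\<close>

text \<open>These are the real and imaginary parts of the characteristic function of the standard normal law.\<close>

lemma integral_std_normal_trig:
  shows "integrable lborel (\<lambda>x. std_normal_density x * cos (t * x))"
    and "integrable lborel (\<lambda>x. std_normal_density x * sin (t * x))"
    and "(\<integral>x. std_normal_density x * cos (t * x) \<partial>lborel) = exp (- t\<^sup>2 / 2)"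
    and "(\<integral>x. std_normal_density x * sin (t * x) \<partial>lborel) = 0"
proof -
  show 1: "integrable lborel (\<lambda>x. std_normal_density x * cos (t * x))"
    by (rule Bochner_Integration.integrable_bound[OF integrable_normal_density[OF zero_less_one, of 0]])
       (auto simp: abs_mult mult_left_le)
  show 2: "integrable lborel (\<lambda>x. std_normal_density x * sin (t * x))"
    by (rule Bochner_Integration.integrable_bound[OF integrable_normal_density[OF zero_less_one, of 0]])
       (auto simp: abs_mult mult_left_le)
  have int: "complex_integrable lborel (\<lambda>x. std_normal_density x *\<^sub>R iexp (t * x))"
    by (rule Bochner_Integration.integrable_bound[OF integrable_normal_density[OF zero_less_one, of 0]])
       (auto simp: abs_mult)
  have ch: "(CLINT x|lborel. std_normal_density x *\<^sub>R iexp (t * x)) = complex_of_real (exp (- t\<^sup>2 / 2))"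
    using fun_cong[OF char_std_normal_distribution, of t] unfolding char_def
    by (subst (asm) integral_density) auto
  show "(\<integral>x. std_normal_density x * cos (t * x) \<partial>lborel) = exp (- t\<^sup>2 / 2)"
    using arg_cong[OF ch, of Re] integral_Re[OF int] by (simp add: Re_exp)
  show "(\<integral>x. std_normal_density x * sin (t * x) \<partial>lborel) = 0"
    using arg_cong[OF ch, of Im] integral_Im[OF int] by (simp add: Im_exp)
qed

lemma has_bochner_integral_affine:
  assumes "v > (0::real)" "has_bochner_integral lborel (\<lambda>x. v * f (m + v * x)) (I::real)"
  shows "has_bochner_integral lborel f I"
proof -
  have "has_bochner_integral lborel (\<lambda>x. 1 / v * (v * f (m + v * x))) (1 / v * I)"
    by (intro has_bochner_integral_mult_right assms)
  also have "(\<lambda>x. 1 / v * (v * f (m + v * x))) = (\<lambda>x. f (m + v * x))"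
    using assms by simp
  also have "1 / v * I = I /\<^sub>R \<bar>v\<bar>"
    using assms by (simp add: divide_inverse)
  finally show ?thesis
    using assms(1) lborel_has_bochner_integral_real_affine_iff[of v f I m] by simp
qed

lemma has_bochner_integral_normal_trig:
  fixes m v t :: real
  assumes v: "v > 0"
  shows "has_bochner_integral lborel (\<lambda>x. normal_density m v x * sin (t * x))
           (exp (- (t * v)\<^sup>2 / 2) * sin (t * m))"
    and "has_bochner_integral lborel (\<lambda>x. normal_density m v x * cos (t * x))
           (exp (- (t * v)\<^sup>2 / 2) * cos (t * m))"
proof -
  have eq: "v * normal_density m v (m + v * x) = std_normal_density x" for x
    using v by (simp add: normal_density_def real_sqrt_mult field_simps)
  have C: "has_bochner_integral lborel (\<lambda>x. std_normal_density x * cos (t * v * x)) (exp (- (t * v)\<^sup>2 / 2))"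
    and S: "has_bochner_integral lborel (\<lambda>x. std_normal_density x * sin (t * v * x)) 0"
    using integral_std_normal_trig[of "t * v"] by (auto simp: has_bochner_integral_iff)
  have "has_bochner_integral lborel
      (\<lambda>x. std_normal_density x * cos (t * v * x) * sin (t * m) + std_normal_density x * sin (t * v * x) * cos (t * m))
      (exp (- (t * v)\<^sup>2 / 2) * sin (t * m) + 0 * cos (t * m))"
    by (intro has_bochner_integral_add has_bochner_integral_mult_left C S)
  also have "(\<lambda>x. std_normal_density x * cos (t * v * x) * sin (t * m) + std_normal_density x * sin (t * v * x) * cos (t * m))
     = (\<lambda>x. v * (normal_density m v (m + v * x) * sin (t * (m + v * x))))"
    by (rule ext) (simp add: sin_add algebra_simps flip: eq)
  finally show "has_bochner_integral lborel (\<lambda>x. normal_density m v x * sin (t * x))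
           (exp (- (t * v)\<^sup>2 / 2) * sin (t * m))"
    by - (rule has_bochner_integral_affine[OF v, where m=m], simp)
  have "has_bochner_integral lborel
      (\<lambda>x. std_normal_density x * cos (t * v * x) * cos (t * m) - std_normal_density x * sin (t * v * x) * sin (t * m))
      (exp (- (t * v)\<^sup>2 / 2) * cos (t * m) - 0 * sin (t * m))"
    by (intro has_bochner_integral_diff has_bochner_integral_mult_left C S)
  also have "(\<lambda>x. std_normal_density x * cos (t * v * x) * cos (t * m) - std_normal_density x * sin (t * v * x) * sin (t * m))
     = (\<lambda>x. v * (normal_density m v (m + v * x) * cos (t * (m + v * x))))"
    by (rule ext) (simp add: cos_add algebra_simps flip: eq)
  finally show "has_bochner_integral lborel (\<lambda>x. normal_density m v x * cos (t * x))
           (exp (- (t * v)\<^sup>2 / 2) * cos (t * m))"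
    by - (rule has_bochner_integral_affine[OF v, where m=m], simp)
qed

section \<open>Normal densities tilted by a sine\<close>

text \<open>Completing the square in \<open>\<xi>\<close>: if \<open>\<xi>\<close> and \<open>x - \<xi>\<close> are independent centred normal variables, this
  factors their joint density into the marginal of the sum \<open>x\<close> and the conditional law of \<open>\<xi>\<close> given \<open>x\<close>.\<close>

lemma normal_density_mult_normal_density:
  fixes s \<tau> :: real
  assumes "s > 0" "\<tau> > 0"
  shows "normal_density 0 s (x - \<xi>) * normal_density 0 \<tau> \<xi> =
    normal_density 0 (sqrt (\<tau>\<^sup>2 + s\<^sup>2)) x *
    normal_density (\<tau>\<^sup>2 / (\<tau>\<^sup>2 + s\<^sup>2) * x) (s * \<tau> / sqrt (\<tau>\<^sup>2 + s\<^sup>2)) \<xi>"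
proof -
  define p q where "p = s\<^sup>2" and "q = \<tau>\<^sup>2"
  have pq: "p > 0" "q > 0" using assms by (auto simp: p_def q_def)
  have v: "(s * \<tau> / sqrt (\<tau>\<^sup>2 + s\<^sup>2))\<^sup>2 = p * q / (q + p)"
    using pq by (simp add: power_mult_distrib power_divide p_def q_def)
  have sq: "sqrt (2 * pi * p) * sqrt (2 * pi * q) = sqrt (2 * pi * (q + p)) * sqrt (2 * pi * (p * q / (q + p)))"
    using pq unfolding real_sqrt_mult[symmetric] by (intro arg_cong[of _ _ sqrt]) (simp add: field_simps)
  have e: "- (x - \<xi>)\<^sup>2 / (2 * p) + - \<xi>\<^sup>2 / (2 * q) =
      - x\<^sup>2 / (2 * (q + p)) + - (\<xi> - q / (q + p) * x)\<^sup>2 / (2 * (p * q / (q + p)))"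
  proof -
    have "q + p \<noteq> 0" using pq by simp
    then show ?thesis
      using pq by (simp add: divide_simps) (simp add: power2_eq_square algebra_simps)
  qed
  have "normal_density 0 s (x - \<xi>) * normal_density 0 \<tau> \<xi> =
     1 / (sqrt (2 * pi * p) * sqrt (2 * pi * q)) * exp (- (x - \<xi>)\<^sup>2 / (2 * p) + - \<xi>\<^sup>2 / (2 * q))"
    by (simp add: normal_density_def mult_exp_exp p_def q_def)
  also have "\<dots> = 1 / (sqrt (2 * pi * (q + p)) * sqrt (2 * pi * (p * q / (q + p)))) *
      exp (- x\<^sup>2 / (2 * (q + p)) + - (\<xi> - q / (q + p) * x)\<^sup>2 / (2 * (p * q / (q + p))))"
    unfolding sq e ..
  also have "\<dots> = normal_density 0 (sqrt (\<tau>\<^sup>2 + s\<^sup>2)) x *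
    normal_density (\<tau>\<^sup>2 / (\<tau>\<^sup>2 + s\<^sup>2) * x) (s * \<tau> / sqrt (\<tau>\<^sup>2 + s\<^sup>2)) \<xi>"
    unfolding normal_density_def v exp_add using pq by (simp add: p_def q_def)
  finally show ?thesis .
qed

text \<open>A sine rather than a cosine is used because an odd perturbation leaves the total mass equal to 1
  for every \<open>\<delta>\<close>.\<close>

definition sine_tilted_normal :: "real \<Rightarrow> real \<Rightarrow> real \<Rightarrow> real \<Rightarrow> real" where
  "sine_tilted_normal \<sigma> b \<delta> x = normal_density 0 \<sigma> x * (1 + \<delta> * sin (b * x))"

lemma sine_tilted_normal_measurable [measurable]: "sine_tilted_normal \<sigma> b \<delta> \<in> borel_measurable borel"
  unfolding sine_tilted_normal_def[abs_def] by measurable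

lemma sine_tilt_nonneg: "\<bar>\<delta>\<bar> \<le> 1 \<Longrightarrow> 0 \<le> 1 + \<delta> * sin (y::real)" for \<delta> :: real
proof -
  assume "\<bar>\<delta>\<bar> \<le> 1"
  then have "\<bar>\<delta> * sin y\<bar> \<le> 1"
    by (simp add: abs_mult mult_le_one)
  then show ?thesis by simp
qed

lemma sine_tilted_normal_nonneg: "\<bar>\<delta>\<bar> \<le> 1 \<Longrightarrow> 0 \<le> sine_tilted_normal \<sigma> b \<delta> x"
  by (simp add: sine_tilted_normal_def sine_tilt_nonneg)

lemma has_bochner_integral_sine_tilted_normal:
  assumes "\<sigma> > 0"
  shows "has_bochner_integral lborel (sine_tilted_normal \<sigma> b \<delta>) 1"
proof -
  have "has_bochner_integral lborel (\<lambda>x. normal_density 0 \<sigma> x + \<delta> * (normal_density 0 \<sigma> x * sin (b * x)))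
    (1 + \<delta> * (exp (- (b * \<sigma>)\<^sup>2 / 2) * sin (b * 0)))"
    using assms
    by (intro has_bochner_integral_add has_bochner_integral_mult_right has_bochner_integral_normal_trig)
       (auto simp: has_bochner_integral_iff)
  then show ?thesis
    by (simp add: sine_tilted_normal_def[abs_def] algebra_simps)
qed

lemma prob_space_sine_tilted_normal:
  assumes "\<sigma> > 0" "\<bar>\<delta>\<bar> \<le> 1"
  shows "prob_space (density lborel (\<lambda>x. ennreal (sine_tilted_normal \<sigma> b \<delta> x)))"
proof
  have "(\<integral>\<^sup>+x. ennreal (sine_tilted_normal \<sigma> b \<delta> x) \<partial>lborel) = 1"
    using has_bochner_integral_sine_tilted_normal[OF assms(1), of b \<delta>]
      sine_tilted_normal_nonneg[OF assms(2), of \<sigma> b]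
    by (subst nn_integral_eq_integral) (auto simp: has_bochner_integral_iff)
  then show "emeasure (density lborel (\<lambda>x. ennreal (sine_tilted_normal \<sigma> b \<delta> x)))
      (space (density lborel (\<lambda>x. ennreal (sine_tilted_normal \<sigma> b \<delta> x)))) = 1"
    by (simp add: emeasure_density)
qed

text \<open>The family is closed under Gaussian convolution: given the sum \<open>x\<close>, the variable \<open>\<xi>\<close> is normal with
  mean proportional to \<open>x\<close> and a variance that does not depend on \<open>x\<close>, so averaging \<open>sin (b * \<xi>)\<close> over
  it gives again a sine in \<open>x\<close>, damped by a constant factor.\<close>

lemma normal_convolve_sine_tilted_normal:
  fixes s \<tau> b \<delta> :: real
  assumes "s > 0" "\<tau> > 0"
  defines "\<sigma> \<equiv> sqrt (\<tau>\<^sup>2 + s\<^sup>2)"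
  shows "has_bochner_integral lborel (\<lambda>\<xi>. normal_density 0 s (x - \<xi>) * sine_tilted_normal \<tau> b \<delta> \<xi>)
    (sine_tilted_normal \<sigma> (b * \<tau>\<^sup>2 / (\<tau>\<^sup>2 + s\<^sup>2))
       (\<delta> * exp (- (b\<^sup>2 * \<tau>\<^sup>2 * s\<^sup>2 / (\<tau>\<^sup>2 + s\<^sup>2)) / 2)) x)"
proof -
  define m where "m = \<tau>\<^sup>2 / (\<tau>\<^sup>2 + s\<^sup>2) * x"
  define v where "v = s * \<tau> / \<sigma>"
  have pos: "\<tau>\<^sup>2 + s\<^sup>2 > 0" using assms by (simp add: add_pos_pos)
  have \<sigma>: "\<sigma> > 0" "\<sigma>\<^sup>2 = \<tau>\<^sup>2 + s\<^sup>2" using pos by (auto simp: \<sigma>_def)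
  have v: "v > 0" "v\<^sup>2 = \<tau>\<^sup>2 * s\<^sup>2 / (\<tau>\<^sup>2 + s\<^sup>2)"
    using assms(1,2) \<sigma> by (auto simp: v_def power_divide power_mult_distrib)
  have "has_bochner_integral lborel
     (\<lambda>\<xi>. normal_density 0 \<sigma> x * (normal_density m v \<xi> + \<delta> * (normal_density m v \<xi> * sin (b * \<xi>))))
     (normal_density 0 \<sigma> x * (1 + \<delta> * (exp (- (b * v)\<^sup>2 / 2) * sin (b * m))))"
    using v(1)
    by (intro has_bochner_integral_add has_bochner_integral_mult_right has_bochner_integral_normal_trig)
       (auto simp: has_bochner_integral_iff)
  moreover have "normal_density 0 s (x - \<xi>) * sine_tilted_normal \<tau> b \<delta> \<xi> =
      normal_density 0 \<sigma> x * (normal_density m v \<xi> + \<delta> * (normal_density m v \<xi> * sin (b * \<xi>)))" for \<xi>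
    unfolding sine_tilted_normal_def mult.assoc[symmetric] normal_density_mult_normal_density[OF assms(1,2)]
    by (simp add: \<sigma>_def m_def v_def algebra_simps)
  moreover have "normal_density 0 \<sigma> x * (1 + \<delta> * (exp (- (b * v)\<^sup>2 / 2) * sin (b * m))) =
     sine_tilted_normal \<sigma> (b * \<tau>\<^sup>2 / (\<tau>\<^sup>2 + s\<^sup>2))
       (\<delta> * exp (- (b\<^sup>2 * \<tau>\<^sup>2 * s\<^sup>2 / (\<tau>\<^sup>2 + s\<^sup>2)) / 2)) x"
    by (simp add: sine_tilted_normal_def power_mult_distrib v(2) m_def mult_ac)
  ultimately show ?thesis by simp
qed

section \<open>Latent densities and the law of the data\<close>

lemma normal_mixture_density_sine_tilted_normal:
  assumes "s > 0" "\<tau> > 0" "\<bar>\<delta>\<bar> \<le> 1"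
  shows "normal_mixture_density s (density lborel (\<lambda>x. ennreal (sine_tilted_normal \<tau> b \<delta> x))) =
    sine_tilted_normal (sqrt (\<tau>\<^sup>2 + s\<^sup>2)) (b * \<tau>\<^sup>2 / (\<tau>\<^sup>2 + s\<^sup>2))
       (\<delta> * exp (- (b\<^sup>2 * \<tau>\<^sup>2 * s\<^sup>2 / (\<tau>\<^sup>2 + s\<^sup>2)) / 2))"
proof
  fix x
  show "normal_mixture_density s (density lborel (\<lambda>x. ennreal (sine_tilted_normal \<tau> b \<delta> x))) x =
    sine_tilted_normal (sqrt (\<tau>\<^sup>2 + s\<^sup>2)) (b * \<tau>\<^sup>2 / (\<tau>\<^sup>2 + s\<^sup>2))
       (\<delta> * exp (- (b\<^sup>2 * \<tau>\<^sup>2 * s\<^sup>2 / (\<tau>\<^sup>2 + s\<^sup>2)) / 2)) x"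
    using has_bochner_integral_integral_eq[OF normal_convolve_sine_tilted_normal[OF assms(1,2), of x b \<delta>]]
    unfolding normal_mixture_density_def
    by (subst integral_density) (auto simp: sine_tilted_normal_nonneg assms(3) mult.commute)
qed

text \<open>The coordinates of the latent vector are independent, and the data apply the same map to each of them;
  so the data are independent too, with the convolution as common law.\<close>

lemma data_law_eq_PiM:
  assumes "prob_space (density lborel g)" "g \<in> borel_measurable borel"
  shows "data_law n g =
    (\<Pi>\<^sub>M i\<in>{..<n}. density lborel g \<star> density lborel (normal_density 0 1))"
proof -
  let ?G = "density lborel g" and ?Z = "density lborel (normal_density 0 1)"
  interpret G: prob_space ?G by fact
  interpret Z: prob_space ?Z by (rule prob_space_normal_density) simp
  interpret GZ: pair_prob_space ?G ?Z ..
  have [measurable]: "g \<in> borel_measurable borel" by fact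
  have "data_law n g = distr (\<Pi>\<^sub>M i\<in>{..<n}. ?G \<Otimes>\<^sub>M ?Z) (\<Pi>\<^sub>M i\<in>{..<n}. return borel 0)
      (compose {..<n} (\<lambda>p. fst p + snd p))"
    \<comment> \<open>The pushforward rule for products wants a probability measure as target; a point mass at 0
       supplies the Borel sets.\<close>
    unfolding data_law_def latent_law_def
    by (intro distr_cong sets_PiM_cong) (auto simp: compose_def)
  also have "\<dots> = (\<Pi>\<^sub>M i\<in>{..<n}. distr (?G \<Otimes>\<^sub>M ?Z) (return borel 0) (\<lambda>p. fst p + snd p))"
    by (intro distr_PiM_finite_prob_space')
       (auto intro: prob_space_return GZ.prob_space_axioms simp: measurable_def[symmetric] cong: measurable_cong_sets)
  also have "\<dots> = (\<Pi>\<^sub>M i\<in>{..<n}. ?G \<star> ?Z)"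
    by (intro PiM_cong refl) (auto simp: convolution_def split_beta intro!: distr_cong)
  finally show ?thesis .
qed

lemma data_law_sine_tilted_normal:
  assumes "\<tau> > 0" "\<bar>\<delta>\<bar> \<le> 1"
  shows "data_law n (sine_tilted_normal \<tau> b \<delta>) =
    (\<Pi>\<^sub>M i\<in>{..<n}. density lborel (\<lambda>x. ennreal (sine_tilted_normal (sqrt (\<tau>\<^sup>2 + 1)) (b * \<tau>\<^sup>2 / (\<tau>\<^sup>2 + 1))
       (\<delta> * exp (- (b\<^sup>2 * \<tau>\<^sup>2 / (\<tau>\<^sup>2 + 1)) / 2)) x)))"
proof -
  let ?g = "sine_tilted_normal \<tau> b \<delta>"
  have P: "prob_space (density lborel (\<lambda>x. ennreal (?g x)))"
    using prob_space_sine_tilted_normal assms by blast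
  have Z: "prob_space (density lborel (\<lambda>x. ennreal (normal_density 0 1 x)))"
    by (rule prob_space_normal_density) simp
  have "(density lborel ?g \<star> density lborel (normal_density 0 1)) =
     (density lborel (normal_density 0 1) \<star> density lborel ?g)"
    by (intro convolution_commutative prob_space.finite_measure P Z) simp_all
  also have "\<dots> = density lborel (\<lambda>x. \<integral>\<^sup>+y. ennreal (normal_density 0 1 (x - y)) * ennreal (?g y) \<partial>lborel)"
    by (intro convolution_density prob_space.finite_measure P Z) simp_all
  also have "(\<lambda>x. \<integral>\<^sup>+y. ennreal (normal_density 0 1 (x - y)) * ennreal (?g y) \<partial>lborel) =
     (\<lambda>x. ennreal (sine_tilted_normal (sqrt (\<tau>\<^sup>2 + 1)) (b * \<tau>\<^sup>2 / (\<tau>\<^sup>2 + 1))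
       (\<delta> * exp (- (b\<^sup>2 * \<tau>\<^sup>2 / (\<tau>\<^sup>2 + 1)) / 2)) x))"
  proof
    fix x
    note I = normal_convolve_sine_tilted_normal[OF zero_less_one assms(1), of x b \<delta>]
    have "(\<integral>\<^sup>+y. ennreal (normal_density 0 1 (x - y)) * ennreal (?g y) \<partial>lborel) =
      (\<integral>\<^sup>+y. ennreal (normal_density 0 1 (x - y) * ?g y) \<partial>lborel)"
      by (simp add: ennreal_mult' sine_tilted_normal_nonneg assms(2))
    also have "\<dots> = ennreal (\<integral>y. normal_density 0 1 (x - y) * ?g y \<partial>lborel)"
      using I by (intro nn_integral_eq_integral)
        (auto simp: has_bochner_integral_iff sine_tilted_normal_nonneg assms(2))
    finally show "(\<integral>\<^sup>+y. ennreal (normal_density 0 1 (x - y)) * ennreal (?g y) \<partial>lborel) =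
      ennreal (sine_tilted_normal (sqrt (\<tau>\<^sup>2 + 1)) (b * \<tau>\<^sup>2 / (\<tau>\<^sup>2 + 1))
       (\<delta> * exp (- (b\<^sup>2 * \<tau>\<^sup>2 / (\<tau>\<^sup>2 + 1)) / 2)) x)"
      using has_bochner_integral_integral_eq[OF I] by simp
  qed
  finally show ?thesis
    using P by (subst data_law_eq_PiM) simp_all
qed

section \<open>The two-point method\<close>

lemma PiM_density_likelihood_ratio:
  fixes r :: "'a \<Rightarrow> ennreal"
  assumes P: "prob_space P" and I: "finite I"
    and r [measurable]: "r \<in> borel_measurable P"
    and "prob_space (density P r)"
  shows "(\<Pi>\<^sub>M i\<in>I. density P r) = density (\<Pi>\<^sub>M i\<in>I. P) (\<lambda>x. \<Prod>i\<in>I. r (x i))"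
proof -
  interpret P: prob_space P by fact
  interpret PP: product_sigma_finite "\<lambda>i. P" ..
  interpret R: prob_space "density P r" by fact
  interpret RR: product_sigma_finite "\<lambda>i. density P r" ..
  show ?thesis
  proof (rule RR.PiM_eqI[symmetric, OF I])
    show "sets (density (\<Pi>\<^sub>M i\<in>I. P) (\<lambda>x. \<Prod>i\<in>I. r (x i))) = sets (\<Pi>\<^sub>M i\<in>I. density P r)"
      by (simp cong: sets_PiM_cong)
    fix A assume A: "\<And>i. i \<in> I \<Longrightarrow> A i \<in> sets (density P r)"
    have m [measurable]: "Pi\<^sub>E I A \<in> sets (\<Pi>\<^sub>M i\<in>I. P)"
      using A I by (intro sets_PiM_I_finite) auto
    have "emeasure (density (\<Pi>\<^sub>M i\<in>I. P) (\<lambda>x. \<Prod>i\<in>I. r (x i))) (Pi\<^sub>E I A) =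
       (\<integral>\<^sup>+x. (\<Prod>i\<in>I. r (x i)) * indicator (Pi\<^sub>E I A) x \<partial>(\<Pi>\<^sub>M i\<in>I. P))"
      by (subst emeasure_density) (auto intro: m)
    also have "\<dots> = (\<integral>\<^sup>+x. (\<Prod>i\<in>I. r (x i) * indicator (A i) (x i)) \<partial>(\<Pi>\<^sub>M i\<in>I. P))"
    proof (intro nn_integral_cong)
      fix x assume x: "x \<in> space (\<Pi>\<^sub>M i\<in>I. P)"
      have "indicator (Pi\<^sub>E I A) x = (\<Prod>i\<in>I. indicator (A i) (x i) :: ennreal)"
      proof (cases "x \<in> Pi\<^sub>E I A")
        case True
        then show ?thesis by (auto simp: PiE_iff indicator_def intro!: prod.neutral[symmetric])
      next
        case False
        then obtain i where "i \<in> I" "x i \<notin> A i"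
          using x by (auto simp: space_PiM PiE_iff)
        then show ?thesis using False I by (auto simp: indicator_def intro!: prod_zero[symmetric])
      qed
      then show "(\<Prod>i\<in>I. r (x i)) * indicator (Pi\<^sub>E I A) x = (\<Prod>i\<in>I. r (x i) * indicator (A i) (x i))"
        by (simp add: prod.distrib)
    qed
    also have "\<dots> = (\<Prod>i\<in>I. \<integral>\<^sup>+x. r x * indicator (A i) x \<partial>P)"
      using A I by (intro PP.product_nn_integral_prod) auto
    also have "\<dots> = (\<Prod>i\<in>I. emeasure (density P r) (A i))"
      using A by (intro prod.cong refl) (auto simp: emeasure_density)
    finally show "emeasure (density (\<Pi>\<^sub>M i\<in>I. P) (\<lambda>x. \<Prod>i\<in>I. r (x i))) (Pi\<^sub>E I A) =
      (\<Prod>i\<in>I. emeasure (density P r) (A i))" .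
  qed
qed

text \<open>This replaces the Cauchy--Schwarz step from the \<open>\<chi>\<^sup>2\<close> distance to total variation: integrated over a
  likelihood ratio \<open>l\<close> with mean 1 and second moment at most 2, it bounds the overlap of the two laws from
  below by \<open>3 / 2 - 1 / 8 - 1 = 3 / 8\<close>.\<close>

lemma min_one_ge_quadratic: "3 / 2 * l \<le> min 1 l + 1 / 8 + l\<^sup>2 / 2" for l :: real
proof -
  have "0 \<le> (l - 3 / 2)\<^sup>2" "0 \<le> (l - 1 / 2)\<^sup>2" by simp_all
  then show ?thesis by (simp add: min_def power2_eq_square algebra_simps)
qed

text \<open>Let \<open>L\<close> be the likelihood ratio of the product laws. Rewriting the second integral under the first
  law turns the sum into the integral of \<open>A + L * B\<close>, which is at least \<open>min 1 L * D\<close>; and the second moment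
  of \<open>L\<close> is at most \<open>(1 + \<kappa>) ^ n \<le> exp (n * \<kappa>) \<le> 2\<close>, with \<open>n\<close> the cardinality of \<open>I\<close>. Here \<open>A\<close> and
  \<open>B\<close> stand for the losses of one estimator against the two hypotheses.\<close>

lemma two_point_testing_bound:
  fixes r :: "'a \<Rightarrow> real" and A B :: "('i \<Rightarrow> 'a) \<Rightarrow> ennreal"
  assumes P: "prob_space P" and I: "finite I"
    and r [measurable]: "r \<in> borel_measurable P" and r_nonneg: "\<And>x. 0 \<le> r x"
    and R: "prob_space (density P (\<lambda>x. ennreal (r x)))"
    and chi: "(\<integral>\<^sup>+x. ennreal ((r x)\<^sup>2) \<partial>P) \<le> ennreal (1 + \<kappa>)" "0 \<le> \<kappa>" "real (card I) * \<kappa> \<le> 1 / 4"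
    and [measurable]: "A \<in> borel_measurable (\<Pi>\<^sub>M i\<in>I. P)" "B \<in> borel_measurable (\<Pi>\<^sub>M i\<in>I. P)"
    and D: "\<And>x. D \<le> A x + B x"
  shows "ennreal (3 / 8) * D \<le> (\<integral>\<^sup>+x. A x \<partial>(\<Pi>\<^sub>M i\<in>I. P)) +
     (\<integral>\<^sup>+x. B x \<partial>(\<Pi>\<^sub>M i\<in>I. density P (\<lambda>x. ennreal (r x))))"
proof -
  interpret P: prob_space P by fact
  interpret PP: product_sigma_finite "\<lambda>i. P" ..
  interpret PI: prob_space "\<Pi>\<^sub>M i\<in>I. P" by (intro prob_space_PiM P)
  interpret R: prob_space "density P (\<lambda>x. ennreal (r x))" by fact
  let ?M = "\<Pi>\<^sub>M i\<in>I. P"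
  define L where "L x = (\<Prod>i\<in>I. r (x i))" for x
  have L_nonneg: "0 \<le> L x" for x by (simp add: L_def prod_nonneg r_nonneg)
  have L_meas [measurable]: "L \<in> borel_measurable ?M" unfolding L_def by measurable
  have ennL: "ennreal (L x) = (\<Prod>i\<in>I. ennreal (r (x i)))" for x
    by (simp add: L_def prod_ennreal r_nonneg)
  have "(\<integral>\<^sup>+x. ennreal (r x) \<partial>P) = 1"
    using R.emeasure_space_1 by (simp add: emeasure_density cong: nn_integral_cong)
  then have L1: "(\<integral>\<^sup>+x. ennreal (L x) \<partial>?M) = 1"
    unfolding ennL by (subst PP.product_nn_integral_prod[OF I]) auto
  have "(\<integral>\<^sup>+x. ennreal ((L x)\<^sup>2) \<partial>?M) = (\<integral>\<^sup>+x. (\<Prod>i\<in>I. ennreal ((r (x i))\<^sup>2)) \<partial>?M)"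
    by (simp add: L_def prod_ennreal prod_power_distrib)
  also have "\<dots> = (\<integral>\<^sup>+x. ennreal ((r x)\<^sup>2) \<partial>P) ^ card I"
    by (subst PP.product_nn_integral_prod[OF I]) auto
  also have "\<dots> \<le> ennreal (1 + \<kappa>) ^ card I"
    by (intro power_mono chi) simp
  also have "\<dots> = ennreal ((1 + \<kappa>) ^ card I)"
    using chi by (intro ennreal_power) simp
  also have "(1 + \<kappa>) ^ card I \<le> exp \<kappa> ^ card I"
    using chi by (intro power_mono exp_ge_add_one_self) auto
  also have "exp \<kappa> ^ card I = exp (real (card I) * \<kappa>)"
    by (simp add: exp_of_nat_mult)
  also have "\<dots> \<le> 2"
    using exp_bound_half[of "real (card I) * \<kappa>"] chi by simp
  finally have L2: "(\<integral>\<^sup>+x. ennreal ((L x)\<^sup>2) \<partial>?M) \<le> 2"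
    by (simp add: ennreal_leI)
  have "ennreal (3 / 2) = ennreal (3 / 2) * (\<integral>\<^sup>+x. ennreal (L x) \<partial>?M)"
    by (simp add: L1)
  also have "\<dots> = (\<integral>\<^sup>+x. ennreal (3 / 2 * L x) \<partial>?M)"
    by (subst nn_integral_cmult[symmetric]) (auto simp: ennreal_mult'[symmetric])
  also have "\<dots> \<le> (\<integral>\<^sup>+x. ennreal (min 1 (L x)) + ennreal (1 / 8) + ennreal (1 / 2) * ennreal ((L x)\<^sup>2) \<partial>?M)"
  proof (intro nn_integral_mono)
    fix x
    have "ennreal (3 / 2 * L x) \<le> ennreal (min 1 (L x) + 1 / 8 + 1 / 2 * (L x)\<^sup>2)"
      using min_one_ge_quadratic[of "L x"] by (intro ennreal_leI) simp
    also have "\<dots> = ennreal (min 1 (L x)) + ennreal (1 / 8) + ennreal (1 / 2 * (L x)\<^sup>2)"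
      using L_nonneg[of x] by (simp flip: ennreal_plus)
    also have "ennreal (1 / 2 * (L x)\<^sup>2) = ennreal (1 / 2) * ennreal ((L x)\<^sup>2)"
      by (rule ennreal_mult') simp
    finally show "ennreal (3 / 2 * L x) \<le> ennreal (min 1 (L x)) + ennreal (1 / 8) + ennreal (1 / 2) * ennreal ((L x)\<^sup>2)" .
  qed
  also have "\<dots> = (\<integral>\<^sup>+x. ennreal (min 1 (L x)) \<partial>?M) + ennreal (1 / 8) + ennreal (1 / 2) * (\<integral>\<^sup>+x. ennreal ((L x)\<^sup>2) \<partial>?M)"
    by (simp add: nn_integral_add nn_integral_cmult PI.emeasure_space_1)
  also have "\<dots> \<le> (\<integral>\<^sup>+x. ennreal (min 1 (L x)) \<partial>?M) + ennreal (1 / 8) + ennreal (1 / 2) * 2"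
    by (intro add_left_mono mult_left_mono L2) simp
  finally have *: "ennreal (3 / 2) \<le> (\<integral>\<^sup>+x. ennreal (min 1 (L x)) \<partial>?M) + ennreal (9 / 8)"
  proof -
    assume a: "ennreal (3 / 2) \<le> (\<integral>\<^sup>+x. ennreal (min 1 (L x)) \<partial>?M) + ennreal (1 / 8) + ennreal (1 / 2) * 2"
    have "ennreal (1 / 8) + ennreal (1 / 2) * ennreal 2 = ennreal (9 / 8)"
      by (subst ennreal_mult'[symmetric], simp, subst ennreal_plus[symmetric]) simp_all
    with a show ?thesis by (simp add: add.assoc)
  qed
  have overlap: "ennreal (3 / 8) \<le> (\<integral>\<^sup>+x. ennreal (min 1 (L x)) \<partial>?M)"
  proof (cases "(\<integral>\<^sup>+x. ennreal (min 1 (L x)) \<partial>?M)")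
    case (real w)
    with * show ?thesis by (simp flip: ennreal_plus)
  qed simp
  have "ennreal (3 / 8) * D \<le> (\<integral>\<^sup>+x. ennreal (min 1 (L x)) \<partial>?M) * D"
    by (intro mult_right_mono overlap) simp
  also have "\<dots> = (\<integral>\<^sup>+x. ennreal (min 1 (L x)) * D \<partial>?M)"
    by (subst nn_integral_multc) auto
  also have "\<dots> \<le> (\<integral>\<^sup>+x. A x + ennreal (L x) * B x \<partial>?M)"
  proof (intro nn_integral_mono)
    fix x
    have "ennreal (min 1 (L x)) * D \<le> ennreal (min 1 (L x)) * A x + ennreal (min 1 (L x)) * B x"
      by (subst distrib_left[symmetric]) (intro mult_left_mono D, simp)
    also have "\<dots> \<le> 1 * A x + ennreal (L x) * B x"
      by (intro add_mono mult_right_mono) (auto simp: ennreal_leI simp flip: ennreal_1)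
    finally show "ennreal (min 1 (L x)) * D \<le> A x + ennreal (L x) * B x" by simp
  qed
  also have "\<dots> = (\<integral>\<^sup>+x. A x \<partial>?M) + (\<integral>\<^sup>+x. B x \<partial>density ?M (\<lambda>x. ennreal (L x)))"
    by (simp add: nn_integral_add nn_integral_density)
  also have "density ?M (\<lambda>x. ennreal (L x)) = (\<Pi>\<^sub>M i\<in>I. density P (\<lambda>x. ennreal (r x)))"
    unfolding ennL by (rule PiM_density_likelihood_ratio[symmetric, OF P I _ R]) simp
  finally show ?thesis .
qed

text \<open>The triangle inequality in squared form: no estimate is close to both hypotheses.\<close>

lemma half_sq_L2_dist_le:
  assumes [measurable]: "h \<in> borel_measurable borel" "g0 \<in> borel_measurable borel" "g1 \<in> borel_measurable borel"
  shows "ennreal (1 / 2) * sq_L2_dist g0 g1 \<le> sq_L2_dist h g0 + sq_L2_dist h g1"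
proof -
  have "ennreal (1 / 2) * sq_L2_dist g0 g1 = (\<integral>\<^sup>+\<theta>. ennreal (1 / 2 * (g0 \<theta> - g1 \<theta>)\<^sup>2) \<partial>lborel)"
    unfolding sq_L2_dist_def
    by (subst nn_integral_cmult[symmetric], measurable, intro nn_integral_cong ennreal_mult'[symmetric]) simp
  also have "\<dots> \<le> (\<integral>\<^sup>+\<theta>. ennreal ((h \<theta> - g0 \<theta>)\<^sup>2) + ennreal ((h \<theta> - g1 \<theta>)\<^sup>2) \<partial>lborel)"
  proof (intro nn_integral_mono)
    fix \<theta>
    have "0 \<le> (2 * h \<theta> - g0 \<theta> - g1 \<theta>)\<^sup>2" by simp
    then have "1 / 2 * (g0 \<theta> - g1 \<theta>)\<^sup>2 \<le> (h \<theta> - g0 \<theta>)\<^sup>2 + (h \<theta> - g1 \<theta>)\<^sup>2"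
      by (simp add: power2_eq_square algebra_simps)
    then show "ennreal (1 / 2 * (g0 \<theta> - g1 \<theta>)\<^sup>2) \<le> ennreal ((h \<theta> - g0 \<theta>)\<^sup>2) + ennreal ((h \<theta> - g1 \<theta>)\<^sup>2)"
      by (simp add: ennreal_leI flip: ennreal_plus)
  qed
  also have "\<dots> = sq_L2_dist h g0 + sq_L2_dist h g1"
    unfolding sq_L2_dist_def by (subst nn_integral_add) auto
  finally show ?thesis .
qed

text \<open>The larger of two risks is at least half their sum, and the testing bound controls the sum.\<close>

lemma minimax_risk_two_point:
  fixes r :: "real \<Rightarrow> real"
  assumes g: "g0 \<in> mixture_class c" "g1 \<in> mixture_class c"
    and gm [measurable]: "g0 \<in> borel_measurable borel" "g1 \<in> borel_measurable borel"
    and law0: "data_law n g0 = (\<Pi>\<^sub>M i\<in>{..<n}. P)"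
    and law1: "data_law n g1 = (\<Pi>\<^sub>M i\<in>{..<n}. density P (\<lambda>x. ennreal (r x)))"
    and P: "prob_space P" and [measurable_cong]: "sets P = sets borel"
    and r: "r \<in> borel_measurable P" "\<And>x. 0 \<le> r x"
    and R: "prob_space (density P (\<lambda>x. ennreal (r x)))"
    and chi: "(\<integral>\<^sup>+x. ennreal ((r x)\<^sup>2) \<partial>P) \<le> ennreal (1 + \<kappa>)" "0 \<le> \<kappa>" "real n * \<kappa> \<le> 1 / 4"
  shows "ennreal (3 / 32) * sq_L2_dist g0 g1 \<le> minimax_risk n c"
  unfolding minimax_risk_def
proof (rule INF_greatest)
  fix e assume "e \<in> estimators n"
  then have e [measurable]: "case_prod e \<in> borel_measurable ((\<Pi>\<^sub>M i\<in>{..<n}. borel) \<Otimes>\<^sub>M borel)"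
    by (simp add: estimators_def)
  have loss_meas: "(\<lambda>x. sq_L2_dist (e x) g) \<in> borel_measurable (\<Pi>\<^sub>M i\<in>{..<n}. P)"
    if [measurable]: "g \<in> borel_measurable borel" for g
    unfolding sq_L2_dist_def by measurable
  have e_meas: "e x \<in> borel_measurable borel" if "x \<in> space (\<Pi>\<^sub>M i\<in>{..<n}. P)" for x
    using measurable_Pair2[OF e, of x] that sets_eq_imp_space_eq[OF \<open>sets P = sets borel\<close>]
    by (simp add: space_PiM)
  \<comment> \<open>The estimate is known to be a measurable function only for data in the sample space, so the
     loss is set to infinity elsewhere; the pointwise bound then holds for all arguments.\<close>
  define A where "A g x = (if x \<in> space (\<Pi>\<^sub>M i\<in>{..<n}. P) then sq_L2_dist (e x) g else \<infinity>)" for g x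
  have A_meas: "A g \<in> borel_measurable (\<Pi>\<^sub>M i\<in>{..<n}. P)" if "g \<in> borel_measurable borel" for g
    using loss_meas[OF that] by (subst measurable_cong[where g="\<lambda>x. sq_L2_dist (e x) g"]) (auto simp: A_def)
  have "ennreal (3 / 8) * (ennreal (1 / 2) * sq_L2_dist g0 g1) \<le>
    (\<integral>\<^sup>+x. A g0 x \<partial>(\<Pi>\<^sub>M i\<in>{..<n}. P)) +
    (\<integral>\<^sup>+x. A g1 x \<partial>(\<Pi>\<^sub>M i\<in>{..<n}. density P (\<lambda>x. ennreal (r x))))"
  proof (rule two_point_testing_bound[OF P _ r R chi(1,2) _ A_meas A_meas])
    fix x
    show "ennreal (1 / 2) * sq_L2_dist g0 g1 \<le> A g0 x + A g1 x"
      using half_sq_L2_dist_le[OF e_meas gm] by (simp add: A_def)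
  qed (use gm chi in auto)
  also have "(\<integral>\<^sup>+x. A g0 x \<partial>(\<Pi>\<^sub>M i\<in>{..<n}. P)) = risk n e g0"
    unfolding risk_def law0 by (intro nn_integral_cong) (simp add: A_def)
  also have "(\<integral>\<^sup>+x. A g1 x \<partial>(\<Pi>\<^sub>M i\<in>{..<n}. density P (\<lambda>x. ennreal (r x)))) = risk n e g1"
    unfolding risk_def law1 by (intro nn_integral_cong) (simp add: A_def space_PiM)
  also have "risk n e g0 + risk n e g1 \<le> (SUP g\<in>mixture_class c. risk n e g) + (SUP g\<in>mixture_class c. risk n e g)"
    by (intro add_mono SUP_upper g)
  also have "ennreal (3 / 8) * (ennreal (1 / 2) * sq_L2_dist g0 g1) = ennreal (3 / 16) * sq_L2_dist g0 g1"
    unfolding mult.assoc[symmetric] by (subst ennreal_mult'[symmetric]) simp_all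
  finally have "ennreal (3 / 16) * sq_L2_dist g0 g1 \<le> 2 * (SUP g\<in>mixture_class c. risk n e g)"
    by (simp add: mult_2)
  then have "ennreal (1 / 2) * (ennreal (3 / 16) * sq_L2_dist g0 g1) \<le>
      ennreal (1 / 2) * (ennreal 2 * (SUP g\<in>mixture_class c. risk n e g))"
    by (intro mult_left_mono) auto
  also have "ennreal (1 / 2) * (ennreal (3 / 16) * sq_L2_dist g0 g1) = ennreal (3 / 32) * sq_L2_dist g0 g1"
    unfolding mult.assoc[symmetric] by (subst ennreal_mult'[symmetric]) simp_all
  also have "ennreal (1 / 2) * (ennreal 2 * (SUP g\<in>mixture_class c. risk n e g)) =
      (SUP g\<in>mixture_class c. risk n e g)"
    unfolding mult.assoc[symmetric] by (subst ennreal_mult'[symmetric]) simp_all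
  finally show "ennreal (3 / 32) * sq_L2_dist g0 g1 \<le> (SUP g\<in>mixture_class c. risk n e g)" .
qed

section \<open>Distance and likelihood ratio of the two hypotheses\<close>

text \<open>The square of a normal density is a multiple of the normal density with half the variance, and
  \<open>2 * (sin y)\<^sup>2 = 1 - cos (2 * y)\<close>.\<close>

lemma sq_L2_dist_sine_tilted_normal:
  assumes "\<sigma> > 0"
  shows "sq_L2_dist (sine_tilted_normal \<sigma> b 0) (sine_tilted_normal \<sigma> b \<delta>) =
    ennreal (\<delta>\<^sup>2 / (4 * sqrt pi * \<sigma>) * (1 - exp (- (b * \<sigma>)\<^sup>2)))"
proof -
  define v where "v = \<sigma> / sqrt 2"
  have v: "v > 0" "v\<^sup>2 = \<sigma>\<^sup>2 / 2" using assms by (auto simp: v_def power_divide)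
  have sq: "(normal_density 0 \<sigma> x)\<^sup>2 = 1 / (2 * sqrt pi * \<sigma>) * normal_density 0 v x" for x
  proof -
    have "sqrt (2 * pi * v\<^sup>2) = sqrt pi * \<sigma>"
      using assms by (simp add: v(2) real_sqrt_mult)
    moreover have "(sqrt (2 * pi * \<sigma>\<^sup>2))\<^sup>2 = 2 * sqrt pi * \<sigma> * (sqrt pi * \<sigma>)"
      by (simp add: power2_eq_square)
    moreover have "(exp (- x\<^sup>2 / (2 * \<sigma>\<^sup>2)))\<^sup>2 = exp (- x\<^sup>2 / (2 * v\<^sup>2))"
      using assms by (simp add: v(2) exp_double[symmetric])
    ultimately show ?thesis
      by (simp add: normal_density_def power_mult_distrib power_divide)
  qed
  let ?k = "\<delta>\<^sup>2 / (4 * sqrt pi * \<sigma>)"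
  have "has_bochner_integral lborel
      (\<lambda>x. ?k * (normal_density 0 v x - normal_density 0 v x * cos (2 * b * x)))
      (?k * (1 - exp (- (2 * b * v)\<^sup>2 / 2) * cos (2 * b * 0)))"
    using v(1)
    by (intro has_bochner_integral_diff has_bochner_integral_mult_right has_bochner_integral_normal_trig)
       (auto simp: has_bochner_integral_iff)
  moreover have "?k * (normal_density 0 v x - normal_density 0 v x * cos (2 * b * x)) =
      (sine_tilted_normal \<sigma> b 0 x - sine_tilted_normal \<sigma> b \<delta> x)\<^sup>2" for x
  proof -
    have "(sine_tilted_normal \<sigma> b 0 x - sine_tilted_normal \<sigma> b \<delta> x)\<^sup>2 =
       (normal_density 0 \<sigma> x)\<^sup>2 * \<delta>\<^sup>2 * (sin (b * x))\<^sup>2"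
      by (simp add: sine_tilted_normal_def power2_eq_square algebra_simps)
    also have "\<dots> = \<delta>\<^sup>2 / (2 * sqrt pi * \<sigma>) * normal_density 0 v x * (sin (b * x))\<^sup>2"
      unfolding sq by simp
    also have "(sin (b * x))\<^sup>2 = (1 - cos (2 * b * x)) / 2"
      using cos_double_sin[of "b * x"] by (simp add: mult.assoc)
    finally show ?thesis by (simp add: field_simps)
  qed
  moreover have "(2 * b * v)\<^sup>2 / 2 = (b * \<sigma>)\<^sup>2"
    by (simp add: power_mult_distrib v(2))
  ultimately have "has_bochner_integral lborel
      (\<lambda>x. (sine_tilted_normal \<sigma> b 0 x - sine_tilted_normal \<sigma> b \<delta> x)\<^sup>2) (?k * (1 - exp (- (b * \<sigma>)\<^sup>2)))"
    by simp
  then show ?thesis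
    unfolding sq_L2_dist_def by (subst nn_integral_eq_integral) (auto simp: has_bochner_integral_iff)
qed

text \<open>On expanding the square, the linear term integrates to 0 since the sine is odd.\<close>

lemma normal_sine_tilt_second_moment:
  assumes "\<sigma> > 0"
  shows "(\<integral>\<^sup>+x. ennreal ((1 + \<delta> * sin (b * x))\<^sup>2) \<partial>density lborel (normal_density 0 \<sigma>)) \<le> ennreal (1 + \<delta>\<^sup>2)"
proof -
  have I: "has_bochner_integral lborel
      (\<lambda>x. (1 + \<delta>\<^sup>2) * normal_density 0 \<sigma> x + 2 * \<delta> * (normal_density 0 \<sigma> x * sin (b * x)))
      ((1 + \<delta>\<^sup>2) * 1 + 2 * \<delta> * (exp (- (b * \<sigma>)\<^sup>2 / 2) * sin (b * 0)))"
    using assms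
    by (intro has_bochner_integral_add has_bochner_integral_mult_right has_bochner_integral_normal_trig)
       (auto simp: has_bochner_integral_iff)
  have le: "normal_density 0 \<sigma> x * (1 + \<delta> * sin (b * x))\<^sup>2 \<le>
      (1 + \<delta>\<^sup>2) * normal_density 0 \<sigma> x + 2 * \<delta> * (normal_density 0 \<sigma> x * sin (b * x))" for x
  proof -
    have "\<delta>\<^sup>2 * (sin (b * x))\<^sup>2 \<le> \<delta>\<^sup>2 * 1"
      by (intro mult_left_mono) (auto simp: abs_square_le_1)
    then have "(1 + \<delta> * sin (b * x))\<^sup>2 \<le> 1 + \<delta>\<^sup>2 + 2 * \<delta> * sin (b * x)"
      by (simp add: power2_sum power_mult_distrib)
    then have "normal_density 0 \<sigma> x * (1 + \<delta> * sin (b * x))\<^sup>2 \<le>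
        normal_density 0 \<sigma> x * (1 + \<delta>\<^sup>2 + 2 * \<delta> * sin (b * x))"
      by (intro mult_left_mono) auto
    then show ?thesis by (simp add: algebra_simps)
  qed
  have "(\<integral>\<^sup>+x. ennreal ((1 + \<delta> * sin (b * x))\<^sup>2) \<partial>density lborel (normal_density 0 \<sigma>)) =
     (\<integral>\<^sup>+x. ennreal (normal_density 0 \<sigma> x * (1 + \<delta> * sin (b * x))\<^sup>2) \<partial>lborel)"
    by (subst nn_integral_density) (auto simp: ennreal_mult'[symmetric])
  also have "\<dots> \<le> (\<integral>\<^sup>+x. ennreal ((1 + \<delta>\<^sup>2) * normal_density 0 \<sigma> x + 2 * \<delta> * (normal_density 0 \<sigma> x * sin (b * x))) \<partial>lborel)"
    by (intro nn_integral_mono ennreal_leI le)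
  also have "\<dots> = ennreal (1 + \<delta>\<^sup>2)"
    using I by (subst nn_integral_eq_integral)
      (auto simp: has_bochner_integral_iff intro!: AE_I2 order_trans[OF _ le])
  finally show ?thesis .
qed

section \<open>Lower bound for given frequency and width\<close>

lemma exp_half_squared: "(exp (- x / 2))\<^sup>2 = exp (- x)" for x :: real
  by (simp add: power2_eq_square mult_exp_exp)

text \<open>The mixing measures \<open>sine_tilted_normal \<tau> b 0\<close> and \<open>sine_tilted_normal \<tau> b \<epsilon>\<close> are convolved first with
  the kernel of the class, then with the noise. The hypothesis \<open>small\<close> says that \<open>n\<close> times the squared
  amplitude left after both convolutions is at most \<open>1 / 4\<close>; the conclusion contains the amplitude after the
  first convolution only.\<close>

lemma minimax_risk_ge_tilted_normal_pair:
  fixes c \<tau> b \<epsilon> :: real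
  assumes c: "c > 0" and \<tau>: "\<tau> > 0" and \<epsilon>: "\<bar>\<epsilon>\<bar> \<le> 1"
    and small: "real n * (\<epsilon>\<^sup>2 * exp (- (b\<^sup>2 * \<tau>\<^sup>2 * (1 + c\<^sup>2) / (\<tau>\<^sup>2 + (1 + c\<^sup>2))))) \<le> 1 / 4"
  shows "ennreal (3 / 32 * (\<epsilon>\<^sup>2 * exp (- (b\<^sup>2 * \<tau>\<^sup>2 * c\<^sup>2 / (\<tau>\<^sup>2 + c\<^sup>2))) / (4 * sqrt pi * sqrt (\<tau>\<^sup>2 + c\<^sup>2)) *
      (1 - exp (- (b\<^sup>2 * \<tau> ^ 4 / (\<tau>\<^sup>2 + c\<^sup>2)))))) \<le> minimax_risk n c"
proof -
  define \<sigma> where "\<sigma> = sqrt (\<tau>\<^sup>2 + c\<^sup>2)"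
  define w where "w = b * \<tau>\<^sup>2 / (\<tau>\<^sup>2 + c\<^sup>2)"
  define \<delta> where "\<delta> = \<epsilon> * exp (- (b\<^sup>2 * \<tau>\<^sup>2 * c\<^sup>2 / (\<tau>\<^sup>2 + c\<^sup>2)) / 2)"
  define \<sigma>' where "\<sigma>' = sqrt (\<sigma>\<^sup>2 + 1)"
  define w' where "w' = w * \<sigma>\<^sup>2 / (\<sigma>\<^sup>2 + 1)"
  define \<eta> where "\<eta> = exp (- (w\<^sup>2 * \<sigma>\<^sup>2 / (\<sigma>\<^sup>2 + 1)) / 2)"
  define g where "g d = sine_tilted_normal \<sigma> w d" for d
  define P where "P = density lborel (\<lambda>x. ennreal (normal_density 0 \<sigma>' x))"
  define r where "r x = 1 + \<delta> * \<eta> * sin (w' * x)" for x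
  have pos: "\<tau>\<^sup>2 + c\<^sup>2 > 0" using c by (simp add: add_nonneg_pos)
  then have \<sigma>: "\<sigma> > 0" "\<sigma>\<^sup>2 = \<tau>\<^sup>2 + c\<^sup>2" by (auto simp: \<sigma>_def)
  have \<sigma>': "\<sigma>' > 0" unfolding \<sigma>'_def by (simp add: add_nonneg_pos)
  have exp_le: "exp (- x / 2) \<le> 1" if "x \<ge> 0" for x :: real using that by simp
  have "\<bar>\<epsilon>\<bar> * exp (- (b\<^sup>2 * \<tau>\<^sup>2 * c\<^sup>2 / (\<tau>\<^sup>2 + c\<^sup>2)) / 2) \<le> 1 * 1"
    by (intro mult_mono \<epsilon> exp_le) auto
  then have \<delta>: "\<bar>\<delta>\<bar> \<le> 1" by (simp add: \<delta>_def abs_mult)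
  have "\<bar>\<delta>\<bar> * \<eta> \<le> 1 * 1"
    unfolding \<eta>_def by (intro mult_mono \<delta> exp_le) auto
  then have \<delta>\<eta>: "\<bar>\<delta> * \<eta>\<bar> \<le> 1" by (simp add: abs_mult \<eta>_def)
  have mem: "sine_tilted_normal \<sigma> w (d * exp (- (b\<^sup>2 * \<tau>\<^sup>2 * c\<^sup>2 / (\<tau>\<^sup>2 + c\<^sup>2)) / 2)) \<in> mixture_class c"
    if "\<bar>d\<bar> \<le> 1" for d
    unfolding mixture_class_def \<sigma>_def w_def
    by (intro CollectI exI[of _ "density lborel (\<lambda>x. ennreal (sine_tilted_normal \<tau> b d x))"] conjI
        prob_space_sine_tilted_normal normal_mixture_density_sine_tilted_normal[symmetric] c \<tau> that) simp
  have g0: "g 0 \<in> mixture_class c" using mem[of 0] by (simp add: g_def)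
  have g1: "g \<delta> \<in> mixture_class c" using mem[OF \<epsilon>] by (simp add: g_def \<delta>_def)
  have law: "data_law n (g d) =
      (\<Pi>\<^sub>M i\<in>{..<n}. density lborel (\<lambda>x. ennreal (sine_tilted_normal \<sigma>' w' (d * \<eta>) x)))"
    if "\<bar>d\<bar> \<le> 1" for d
    unfolding g_def \<sigma>'_def w'_def \<eta>_def by (rule data_law_sine_tilted_normal[OF \<sigma>(1) that])
  have law0: "data_law n (g 0) = (\<Pi>\<^sub>M i\<in>{..<n}. P)"
    using law[of 0] by (simp add: P_def sine_tilted_normal_def[abs_def])
  have dens: "density P (\<lambda>x. ennreal (r x)) =
      density lborel (\<lambda>x. ennreal (sine_tilted_normal \<sigma>' w' (\<delta> * \<eta>) x))"
    unfolding P_def r_def[abs_def]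
    by (subst density_density_eq) (auto simp: sine_tilted_normal_def ennreal_mult'[symmetric])
  \<comment> \<open>Convolving with the kernel and then with the noise is one convolution with a normal density
     of variance \<open>1 + c\<^sup>2\<close>, so the damping exponents add up to that of the latter.\<close>
  have exponent: "b\<^sup>2 * \<tau>\<^sup>2 * c\<^sup>2 / (\<tau>\<^sup>2 + c\<^sup>2) + w\<^sup>2 * \<sigma>\<^sup>2 / (\<sigma>\<^sup>2 + 1) =
      b\<^sup>2 * \<tau>\<^sup>2 * (1 + c\<^sup>2) / (\<tau>\<^sup>2 + (1 + c\<^sup>2))"
  proof -
    define p q where "p = \<tau>\<^sup>2" and "q = c\<^sup>2"
    have *: "p + q > 0" "p + q + 1 > 0" using pos by (auto simp: p_def q_def)
    have "b\<^sup>2 * p * q / u + (b * p / u)\<^sup>2 * u / (u + 1) = b\<^sup>2 * p * ((q * (u + 1) + p) / (u * (u + 1)))"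
      if "u > 0" for u
    proof -
      have "u + 1 \<noteq> 0" using that by simp
      with that show ?thesis by (simp add: divide_simps power2_eq_square) (simp add: algebra_simps)
    qed
    from this[OF *(1)]
    have "b\<^sup>2 * p * q / (p + q) + (b * p / (p + q))\<^sup>2 * (p + q) / (p + q + 1) =
      b\<^sup>2 * p * ((q * (p + q + 1) + p) / ((p + q) * (p + q + 1)))" .
    also have "q * (p + q + 1) + p = (1 + q) * (p + q)"
      by (simp add: algebra_simps)
    also have "(1 + q) * (p + q) / ((p + q) * (p + q + 1)) = (1 + q) / (p + (1 + q))"
      using * by (simp add: add_ac)
    finally show ?thesis
      by (simp add: w_def \<sigma>(2) p_def q_def)
  qed
  have "(\<delta> * \<eta>)\<^sup>2 = \<epsilon>\<^sup>2 * exp (- (b\<^sup>2 * \<tau>\<^sup>2 * (1 + c\<^sup>2) / (\<tau>\<^sup>2 + (1 + c\<^sup>2))))"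
    unfolding exponent[symmetric]
    by (simp only: \<delta>_def \<eta>_def power_mult_distrib exp_half_squared) (simp add: mult_exp_exp)
  then have small': "real n * (\<delta> * \<eta>)\<^sup>2 \<le> 1 / 4" using small by simp
  have "ennreal (3 / 32) * sq_L2_dist (g 0) (g \<delta>) \<le> minimax_risk n c"
  proof (rule minimax_risk_two_point[where r = r, OF g0 g1 _ _ law0 _ _ _ _ _ _ _ _ small'])
    show "data_law n (g \<delta>) = (\<Pi>\<^sub>M i\<in>{..<n}. density P (\<lambda>x. ennreal (r x)))"
      unfolding dens by (rule law[OF \<delta>])
    show "prob_space P" unfolding P_def by (rule prob_space_normal_density[OF \<sigma>'])
    show "prob_space (density P (\<lambda>x. ennreal (r x)))"
      unfolding dens by (rule prob_space_sine_tilted_normal[OF \<sigma>' \<delta>\<eta>])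
    show "0 \<le> r x" for x unfolding r_def by (rule sine_tilt_nonneg[OF \<delta>\<eta>])
    show "(\<integral>\<^sup>+x. ennreal ((r x)\<^sup>2) \<partial>P) \<le> ennreal (1 + (\<delta> * \<eta>)\<^sup>2)"
      unfolding P_def r_def by (rule normal_sine_tilt_second_moment[OF \<sigma>'])
  qed (auto simp: g_def P_def r_def[abs_def])
  moreover have "sq_L2_dist (g 0) (g \<delta>) = ennreal (\<delta>\<^sup>2 / (4 * sqrt pi * \<sigma>) * (1 - exp (- (w * \<sigma>)\<^sup>2)))"
    unfolding g_def by (rule sq_L2_dist_sine_tilted_normal[OF \<sigma>(1)])
  moreover have "\<delta>\<^sup>2 = \<epsilon>\<^sup>2 * exp (- (b\<^sup>2 * \<tau>\<^sup>2 * c\<^sup>2 / (\<tau>\<^sup>2 + c\<^sup>2)))"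
    by (simp only: \<delta>_def power_mult_distrib exp_half_squared)
  moreover have "(w * \<sigma>)\<^sup>2 = b\<^sup>2 * \<tau> ^ 4 / (\<tau>\<^sup>2 + c\<^sup>2)"
  proof -
    have "(w * \<sigma>)\<^sup>2 = b\<^sup>2 * (\<tau>\<^sup>2)\<^sup>2 * (\<tau>\<^sup>2 + c\<^sup>2) / (\<tau>\<^sup>2 + c\<^sup>2)\<^sup>2"
      by (simp add: power_mult_distrib power_divide w_def \<sigma>(2))
    then show ?thesis using pos by (simp add: power2_eq_square[of "\<tau>\<^sup>2 + c\<^sup>2"] flip: power_mult)
  qed
  ultimately show ?thesis
    unfolding \<sigma>_def[symmetric] by (subst ennreal_mult') auto
qed

section \<open>The minimax rate\<close>

theorem theorem2p2:
  fixes c \<alpha> :: real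
  assumes "c > 0"
    and "\<alpha> = c\<^sup>2 / (1 + c\<^sup>2)"
  shows "\<exists>C>0. \<forall>\<^sub>F n in sequentially.
           minimax_risk n c \<ge> ennreal (C * real n powr (- \<alpha>) * ln (real n) powr (- (1 / 2)))"
proof -
  define q where "q = 1 + c\<^sup>2"
  \<comment> \<open>The factor \<open>exp (- q\<^sup>2 / 2)\<close> absorbs the bounded gap between the damping exponent for
     the observations and \<open>ln n\<close>; halving then makes \<open>n * \<delta>\<^sup>2\<close> at most \<open>1 / 4\<close>.\<close>
  define \<epsilon> where "\<epsilon> = exp (- q\<^sup>2 / 2) / 2"
  define C where "C = 3 / 32 * (\<epsilon>\<^sup>2 / (4 * sqrt pi * sqrt 2) * (1 / 2))"
  have q: "q \<ge> 1" by (simp add: q_def)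
  have \<epsilon>: "\<bar>\<epsilon>\<bar> \<le> 1" by (auto simp: \<epsilon>_def intro: order_trans[of _ 1])
  have \<epsilon>2: "\<epsilon>\<^sup>2 = exp (- q\<^sup>2) / 4"
    unfolding \<epsilon>_def power_divide exp_half_squared by simp
  have \<epsilon>_pos: "\<epsilon>\<^sup>2 > 0" by (simp add: \<epsilon>_def)
  \<comment> \<open>From here on \<open>ln n / q\<close> exceeds both 2 and \<open>c\<^sup>2\<close>.\<close>
  have "\<forall>\<^sub>F n in sequentially. real n \<ge> exp (q * (2 + c\<^sup>2))"
    using filterlim_real_sequentially unfolding filterlim_at_top by blast
  then have "\<forall>\<^sub>F n in sequentially.
      ennreal (C * real n powr (- \<alpha>) * ln (real n) powr (- (1 / 2))) \<le> minimax_risk n c"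
  proof eventually_elim
    case (elim n)
    define t where "t = ln (real n) / q"
    define \<tau> where "\<tau> = sqrt t"
    have n: "real n > 0" using elim by (smt (verit) exp_gt_zero)
    have "ln (real n) \<ge> q * (2 + c\<^sup>2)" using elim n by (simp add: ln_ge_iff)
    then have t: "t \<ge> 2 + c\<^sup>2" using q by (simp add: t_def field_simps)
    have t0: "t > 0" "t \<ge> 2" "t \<ge> c\<^sup>2" using t zero_le_power2[of c] by linarith+
    have lnn: "ln (real n) = q * t" using q by (simp add: t_def)
    have \<tau>: "\<tau> > 0" "\<tau>\<^sup>2 = t" "\<tau> ^ 4 = t\<^sup>2"
      using t0 power_mult[of \<tau> 2 2] by (auto simp: \<tau>_def)
    have n_eq: "real n = exp (q * t)" using n lnn by (metis exp_ln)
    \<comment> \<open>With \<open>b = \<tau>\<close> and \<open>\<tau>\<^sup>2 = t\<close>, the damping exponent for the observations falls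
       short of \<open>ln n\<close> by at most \<open>q\<^sup>2\<close>.\<close>
    have "t * t * q / (t + q) \<ge> q * t - q\<^sup>2"
    proof -
      have "(q * t - q\<^sup>2) * (t + q) = t * t * q - q ^ 3"
        by (simp add: power2_eq_square power3_eq_cube algebra_simps)
      also have "\<dots> \<le> t * t * q" using q by simp
      finally show ?thesis using t0 q by (simp add: pos_le_divide_eq)
    qed
    then have "real n * (\<epsilon>\<^sup>2 * exp (- (t * t * q / (t + q)))) \<le> real n * (\<epsilon>\<^sup>2 * exp (q\<^sup>2 - q * t))"
      by (intro mult_left_mono) auto
    also have "\<dots> = 1 / 4"
      by (simp add: n_eq \<epsilon>2 mult_exp_exp)
    finally have small: "real n * (\<epsilon>\<^sup>2 * exp (- (t * t * q / (t + q)))) \<le> 1 / 4" .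
    have "c\<^sup>2 = \<alpha> * q" using assms(2) q by (simp add: q_def[symmetric])
    then have pw: "real n powr (- \<alpha>) = exp (- (t * c\<^sup>2))"
      using n by (simp add: powr_def lnn mult_ac)
    have e1: "exp (- (t * c\<^sup>2)) \<le> exp (- (t * t * c\<^sup>2 / (t + c\<^sup>2)))"
    proof -
      have "t * t * c\<^sup>2 \<le> t * c\<^sup>2 * (t + c\<^sup>2)" using t0 by (simp add: algebra_simps)
      then show ?thesis using t0 by (simp add: pos_divide_le_eq add_pos_nonneg)
    qed
    have e2: "ln (real n) powr (- (1 / 2)) / sqrt 2 \<le> 1 / sqrt (t + c\<^sup>2)"
    proof -
      have "t + c\<^sup>2 \<le> 2 * ln (real n)"
      proof -
        have "t \<le> q * t" using mult_right_mono[OF q, of t] t0 by simp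
        with t0 show ?thesis unfolding lnn by linarith
      qed
      then have "sqrt (t + c\<^sup>2) \<le> sqrt 2 * sqrt (ln (real n))"
        by (simp flip: real_sqrt_mult)
      moreover have "0 < sqrt (t + c\<^sup>2)" using t0 by (simp add: add_pos_nonneg)
      ultimately have "1 / (sqrt 2 * sqrt (ln (real n))) \<le> 1 / sqrt (t + c\<^sup>2)"
        by (intro divide_left_mono mult_pos_pos) (auto simp: lnn t0 q less_le_trans[OF zero_less_one q])
      moreover have "ln (real n) powr (- (1 / 2)) = 1 / sqrt (ln (real n))"
      proof -
        have "ln (real n) \<ge> 0" using t0 q by (simp add: lnn)
        then show ?thesis by (simp only: powr_minus_divide powr_half_sqrt)
      qed
      ultimately show ?thesis by (simp only: divide_divide_eq_left mult.commute[of "sqrt 2"])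
    qed
    have e3: "1 / 2 \<le> 1 - exp (- (t * t\<^sup>2 / (t + c\<^sup>2)))"
    proof -
      have "1 * (t + c\<^sup>2) \<le> t * 2" using t0 by simp
      also have "\<dots> \<le> t * t\<^sup>2"
        using t0 mult_mono[of 1 t 2 t] by (intro mult_left_mono) (auto simp: power2_eq_square)
      finally have "1 \<le> t * t\<^sup>2 / (t + c\<^sup>2)" using t0 by (simp add: pos_le_divide_eq add_pos_nonneg)
      then have "exp (- (t * t\<^sup>2 / (t + c\<^sup>2))) \<le> exp (- 1)" by simp
      also have "\<dots> \<le> 1 / 2"
        using exp_ge_add_one_self[of 1] by (simp add: exp_minus field_simps)
      finally show ?thesis by simp
    qed
    have "C * real n powr (- \<alpha>) * ln (real n) powr (- (1 / 2)) =
      3 / 32 * (\<epsilon>\<^sup>2 * exp (- (t * c\<^sup>2)) / (4 * sqrt pi) * (ln (real n) powr (- (1 / 2)) / sqrt 2) * (1 / 2))"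
      by (simp add: C_def pw)
    also have "\<dots> \<le> 3 / 32 * (\<epsilon>\<^sup>2 * exp (- (t * t * c\<^sup>2 / (t + c\<^sup>2))) / (4 * sqrt pi) * (1 / sqrt (t + c\<^sup>2)) *
        (1 - exp (- (t * t\<^sup>2 / (t + c\<^sup>2)))))"
      by (intro mult_left_mono mult_mono divide_right_mono e1 e2 e3) (use t0 in auto)
    also have "ennreal \<dots> \<le> minimax_risk n c"
      using minimax_risk_ge_tilted_normal_pair[OF assms(1) \<tau>(1) \<epsilon>, of n \<tau>] small
      by (simp add: \<tau>(2,3) flip: q_def)
    finally show ?case by (simp add: ennreal_leI)
  qed
  moreover have "C > 0" using \<epsilon>_pos by (simp add: C_def)
  ultimately show ?thesis by blast
qed

end
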